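(* Let $n\ge 0$ be an integer, let $G_n$ be the random Gram matrix of size $n$, and for $i\ge 0$ let $a_i=E(\det(G_i))$ and $p_i=E(\operatorname{perm}(G_i))$. Let $b_i, d_i$ ($0\le i\le n$) be the (random) sign-adjusted coefficients of, respectively, the characteristic and permanental polynomials of $G_n$: $$\det(\lambda I - G_n) = b_0\lambda^n - b_1\lambda^{n-1} + \cdots + (-1)^n b_n,$$ $$\operatorname{perm}(\lambda I - G_n) = d_0\lambda^n - d_1\lambda^{n-1} + \cdots + (-1)^n d_n.$$ Then, for every $0\le i\le n$, $$E(b_i) = \binom{n}{i} a_i \qquad\text{and}\qquad E(d_i) = \binom{n}{i} p_i.$$
   Context: Let $t\ge 1$ be an integer and let $w=(w_1,\dots,w_t)^T$ be a random vector whose components are real random variables (not necessarily independent or identically distributed), with all second moments $E(w_iw_j)$ finite. For each $n\ge 0$, let $w^{(1)},\dots,w^{(n)}$ be $n$ independent random vectors, each with the same distribution as $w$; let $A$ be the $t\times n$ matrix with columns $w^{(1)},\dots,w^{(n)}$. The random Gram matrix of size $n$ is the $n\times n$ matrix $G_n=A^TA$, so that $(G_n)_{ij}=w^{(i)}\cdot w^{(j)}$. $E$ denotes expectation, and $\operatorname{perm}(B)=\sum_{\sigma\in S_n}\prod_{i=1}^n B_{i,\sigma(i)}$ is the permanent of an $n\times n$ matrix $B$. By convention the determinant and permanent of the $0\times 0$ matrix equal $1$, so $a_0=p_0=1$. *)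

theory Defs
  imports "HOL-Probability.Probability" "Jordan_Normal_Form.Char_Poly"
begin

definition permanent :: "'a :: comm_ring_1 mat \<Rightarrow> 'a" where
  "permanent A = (if dim_row A = dim_col A
     then (\<Sum>p \<in> {p. p permutes {0..<dim_row A}}. \<Prod>i = 0..<dim_row A. A $$ (i, p i))
     else 0)"

(* char_poly_matrix A is the polynomial matrix (X * I - A), and char_poly A is its determinant. *)
definition perm_poly :: "'a :: comm_ring_1 mat \<Rightarrow> 'a poly" where
  "perm_poly A = permanent (char_poly_matrix A)"

definition char_coeff :: "'a :: comm_ring_1 mat \<Rightarrow> nat \<Rightarrow> 'a" where
  "char_coeff A i = (- 1) ^ i * coeff (char_poly A) (dim_row A - i)"

definition perm_coeff :: "'a :: comm_ring_1 mat \<Rightarrow> nat \<Rightarrow> 'a" where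
  "perm_coeff A i = (- 1) ^ i * coeff (perm_poly A) (dim_row A - i)"

(* The columns of the matrix A are x 0, ..., x (n - 1), so the entries of A^T A are
   their pairwise dot products; see gram_mat_index. *)
definition gram_mat :: "nat \<Rightarrow> (nat \<Rightarrow> real ^ 't) \<Rightarrow> real mat" where
  "gram_mat n x = Matrix.mat n n (\<lambda>(i, j). inner (x i) (x j))"

lemma gram_mat_carrier [simp]: "gram_mat n x \<in> carrier_mat n n"
  by (simp add: gram_mat_def)

lemma gram_mat_index:
  assumes "i < n" "j < n"
  shows "gram_mat n x $$ (i, j) = (\<Sum>c\<in>UNIV. vec_nth (x i) c * vec_nth (x j) c)"
  using assms by (simp add: gram_mat_def inner_vec_def)

lemma poly_sign_adjusted_expansion:
  fixes p :: "'a :: comm_ring_1 poly"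
  assumes "degree p \<le> n"
  shows "p = (\<Sum>i\<le>n. monom ((- 1) ^ i * ((- 1) ^ i * coeff p (n - i))) (n - i))"
proof -
  have "p = (\<Sum>i\<le>n. monom (coeff p i) i)"
    using assms by (simp add: poly_as_sum_of_monoms')
  also have "\<dots> = (\<Sum>i\<le>n. monom (coeff p (n - i)) (n - i))"
    by (rule sum.reindex_bij_witness[of _ "\<lambda>i. n - i" "\<lambda>i. n - i"]) auto
  also have "\<dots> = (\<Sum>i\<le>n. monom ((- 1) ^ i * ((- 1) ^ i * coeff p (n - i))) (n - i))"
    by (simp flip: mult.assoc power_mult_distrib)
  finally show ?thesis .
qed

lemma degree_char_poly_matrix_index:
  assumes "A \<in> carrier_mat n n" "i < n" "j < n"
  shows "degree (char_poly_matrix A $$ (i, j)) \<le> 1"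
  using assms by (auto simp: char_poly_matrix_def intro!: degree_add_le)

lemma degree_perm_poly_le:
  assumes A: "A \<in> carrier_mat n n"
  shows "degree (perm_poly A) \<le> n"
proof -
  have "degree (\<Prod>i = 0..<n. char_poly_matrix A $$ (i, p i)) \<le> n"
    if p: "p permutes {0..<n}" for p
  proof -
    have "degree (\<Prod>i = 0..<n. char_poly_matrix A $$ (i, p i))
        \<le> (\<Sum>i = 0..<n. degree (char_poly_matrix A $$ (i, p i)))"
      using degree_prod_sum_le[of "{0..<n}" "\<lambda>i. char_poly_matrix A $$ (i, p i)"]
      by (simp add: comp_def)
    also have "\<dots> \<le> (\<Sum>i = 0..<n. 1)"
      using permutes_in_image[OF p]
      by (intro sum_mono degree_char_poly_matrix_index[OF A]) auto
    finally show ?thesis by simp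
  qed
  then show ?thesis
    using char_poly_matrix_closed[OF A]
    by (auto simp: perm_poly_def permanent_def finite_permutations intro!: degree_sum_le)
qed

lemma char_poly_expansion:
  assumes A: "(A :: 'a :: idom mat) \<in> carrier_mat n n"
  shows "char_poly A = (\<Sum>i\<le>n. monom ((- 1) ^ i * char_coeff A i) (n - i))"
  using poly_sign_adjusted_expansion[of "char_poly A" n] degree_monic_char_poly[OF A] A
  by (simp add: char_coeff_def)

lemma perm_poly_expansion:
  assumes A: "A \<in> carrier_mat n n"
  shows "perm_poly A = (\<Sum>i\<le>n. monom ((- 1) ^ i * perm_coeff A i) (n - i))"
  using poly_sign_adjusted_expansion[of "perm_poly A" n] degree_perm_poly_le[OF A] A
  by (simp add: perm_coeff_def)

end

theory Submission
  imports Defs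
begin

text \<open>
  The coefficient of $\lambda^{n-i}$ in $\det(\lambda I - G)$ is, up to the sign $(-1)^i$, the sum
  of the principal $i \times i$ minors of $G$, and the same holds for permanents. A principal
  submatrix of a random Gram matrix of size $n$ is the Gram matrix of $i$ of the $n$ vectors. These
  are again independent copies of $w$, so each of the $\binom{n}{i}$ principal minors has the same
  expectation as $\det(G_i)$ or $\operatorname{perm}(G_i)$.

  Determinant and permanent are treated at once, as immanants: sums over permutations $p$ weighted
  by a function $\varphi(p)$. The expansion into principal submatrices
  (\<open>coeff_immanant_char_poly_matrix\<close>) works for every weight, because the diagonal entries
  $\lambda - G_{kk}$ contribute a $\lambda$ only at fixed points of $p$. Identifying the
  contribution of an index set $S$ with an immanant of size $i$ (\<open>sum_permutes_relabel\<close>)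
  only needs that $\varphi$ is unchanged when the points that $p$ moves are renamed.

  That the $n$ vectors of $G_n$ and the $i$ vectors of $G_i$ may live on different probability
  spaces is harmless, since the expectation is a polynomial in the second moments of $w$. For a fixed
  permutation $p$, expanding the dot products in
  $\prod_k w^{(k)} \cdot w^{(p(k))}$ over functions $f$ from indices to coordinates and collecting
  the two factors that belong to the same vector gives
  $\sum_f \prod_k w^{(k)}_{f(k)} w^{(k)}_{f(p^{-1}(k))}$.
  By independence its expectation is $\sum_f \prod_k E(w_{f(k)} w_{f(p^{-1}(k))})$
  (\<open>expectation_prod_inner_permuted\<close>), and each factor is one of the moments assumed finite.
  This also gives integrability of all the random variables involved.
\<close>

section \<open>Immanants and their behaviour under relabelling\<close>

definition immanant :: "((nat \<Rightarrow> nat) \<Rightarrow> int) \<Rightarrow> 'a :: comm_ring_1 mat \<Rightarrow> 'a" where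
  "immanant \<phi> A = (\<Sum>p | p permutes {0..<dim_row A}.
     of_int (\<phi> p) * (\<Prod>k = 0..<dim_row A. A $$ (k, p k)))"

text \<open>
  For bijections of a set onto itself this says that the weight is a class function. Bijections
  between different sets are needed as well, because a permutation of an index set \<open>S\<close> has to be
  compared with one of \<open>{0..<card S}\<close>; both are functions on all of \<open>nat\<close>.
\<close>

definition relabelling_invariant :: "((nat \<Rightarrow> nat) \<Rightarrow> int) \<Rightarrow> bool" where
  "relabelling_invariant \<phi> \<longleftrightarrow> (\<forall>S T e p. finite S \<longrightarrow> bij_betw e S T \<longrightarrow> p permutes S \<longrightarrow>
     \<phi> (map_permutation S e p) = \<phi> p)"

lemma det_eq_immanant: "A \<in> carrier_mat n n \<Longrightarrow> Determinant.det A = immanant sign A"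
  by (auto simp: Determinant.det_def immanant_def)

lemma permanent_eq_immanant: "A \<in> carrier_mat n n \<Longrightarrow> permanent A = immanant (\<lambda>_. 1) A"
  by (auto simp: permanent_def immanant_def)

lemma relabelling_invariant_sign: "relabelling_invariant sign"
  unfolding relabelling_invariant_def
  by (blast intro: sign_map_permutation dest: bij_betw_imp_inj_on)

lemma relabelling_invariant_one: "relabelling_invariant (\<lambda>_. 1)"
  by (simp add: relabelling_invariant_def)

text \<open>
  Conjugation by \<open>e\<close> is a bijection between the permutations of \<open>T\<close> and those of \<open>S\<close>. With
  \<open>T = {0..<i}\<close> this turns the contribution of a set \<open>S\<close> of \<open>i\<close> indices into an immanant of an
  \<open>i \<times> i\<close> matrix.
\<close>

lemma sum_permutes_relabel:
  assumes \<phi>: "relabelling_invariant \<phi>" and T: "finite T" and e: "bij_betw e T S"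
  shows "(\<Sum>p | p permutes S. of_int (\<phi> p) * (\<Prod>k\<in>S. B k (p k))) =
         (\<Sum>p | p permutes T. of_int (\<phi> p) * (\<Prod>k\<in>T. B (e k) (e (p k)) :: 'a :: comm_ring_1))"
proof -
  let ?g = "inv_into T e"
  have g: "bij_betw ?g S T"
    using e by (rule bij_betw_inv_into)
  have inj: "inj_on e T"
    using e by (rule bij_betw_imp_inj_on)
  have "(\<Sum>p | p permutes T. of_int (\<phi> p) * (\<Prod>k\<in>T. B (e k) (e (p k)))) =
      (\<Sum>p | p permutes S. of_int (\<phi> p) * (\<Prod>k\<in>S. B k (p k)))"
  proof (rule sum.reindex_bij_witness[of _ "map_permutation S ?g" "map_permutation T e"])
    fix p assume "p \<in> {p. p permutes T}"
    then have p: "p permutes T" by simp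
    show "map_permutation S ?g (map_permutation T e p) = p"
      by (rule map_permutation_compose_inv[OF e p]) (simp add: inj)
    show "map_permutation T e p \<in> {p. p permutes S}"
      using map_permutation_permutes[OF e p] by simp
    have "(\<Prod>k\<in>S. B k (map_permutation T e p k)) = (\<Prod>k\<in>T. B (e k) (map_permutation T e p (e k)))"
      by (rule prod.reindex_bij_betw[OF e, symmetric])
    also have "\<dots> = (\<Prod>k\<in>T. B (e k) (e (p k)))"
      by (simp add: map_permutation_apply[OF inj])
    finally show "of_int (\<phi> (map_permutation T e p)) * (\<Prod>k\<in>S. B k (map_permutation T e p k)) =
        of_int (\<phi> p) * (\<Prod>k\<in>T. B (e k) (e (p k)))"
      using \<phi> T e p unfolding relabelling_invariant_def by metis
  next
    fix p assume "p \<in> {p. p permutes S}"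
    then have p: "p permutes S" by simp
    show "map_permutation T e (map_permutation S ?g p) = p"
      by (rule map_permutation_compose_inv[OF g p]) (use e in \<open>auto simp: bij_betw_def f_inv_into_f\<close>)
    show "map_permutation S ?g p \<in> {p. p permutes T}"
      using map_permutation_permutes[OF g p] by simp
  qed
  then show ?thesis ..
qed

section \<open>Coefficients as sums over principal submatrices\<close>

text \<open>
  Multiplying out, \<open>S\<close> collects the factors from which the constant term \<open>- A $$ (k, p k)\<close> is
  taken. The other factors contribute \<open>X\<close> at fixed points of \<open>p\<close> and \<open>0\<close> elsewhere, so that only
  those \<open>S\<close> survive outside of which \<open>p\<close> is the identity, with the power \<open>X ^ (n - card S)\<close>.
\<close>

lemma coeff_prod_char_poly_matrix:
  fixes A :: "'a :: comm_ring_1 mat"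
  assumes A: "A \<in> carrier_mat n n" and p: "p permutes {0..<n}" and i: "i \<le> n"
  shows "coeff (\<Prod>k = 0..<n. char_poly_matrix A $$ (k, p k)) (n - i) =
    (\<Sum>S \<in> Pow {0..<n}. if card S = i \<and> p permutes S then (- 1) ^ i * (\<Prod>k\<in>S. A $$ (k, p k)) else 0)"
proof -
  let ?x = "\<lambda>k. if p k = k then monom 1 1 else (0 :: 'a poly)"
  have entry: "char_poly_matrix A $$ (k, p k) = [:- A $$ (k, p k):] + ?x k" if "k \<in> {0..<n}" for k
    using that A permutes_in_image[OF p, of k]
    by (auto simp: char_poly_matrix_def monom_altdef)
  have "(\<Prod>k = 0..<n. char_poly_matrix A $$ (k, p k)) =
      (\<Sum>S\<in>Pow {0..<n}. (\<Prod>k\<in>S. [:- A $$ (k, p k):]) * (\<Prod>k\<in>{0..<n} - S. ?x k))"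
    by (simp add: entry prod_add)
  then have "coeff (\<Prod>k = 0..<n. char_poly_matrix A $$ (k, p k)) (n - i) =
      (\<Sum>S\<in>Pow {0..<n}. coeff ((\<Prod>k\<in>S. [:- A $$ (k, p k):]) * (\<Prod>k\<in>{0..<n} - S. ?x k)) (n - i))"
    by (simp add: coeff_sum)
  also have "\<dots> = (\<Sum>S \<in> Pow {0..<n}.
      if card S = i \<and> p permutes S then (- 1) ^ i * (\<Prod>k\<in>S. A $$ (k, p k)) else 0)"
  proof (rule sum.cong[OF refl])
    fix S assume "S \<in> Pow {0..<n}"
    then have S: "S \<subseteq> {0..<n}" by simp
    then have fin: "finite S" by (rule finite_subset) simp
    have card: "card ({0..<n} - S) = n - card S" "card S \<le> n"
      using S fin card_mono[OF _ S] by (simp_all add: card_Diff_subset)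
    have const: "(\<Prod>k\<in>S. [:- A $$ (k, p k):]) = monom ((- 1) ^ card S * (\<Prod>k\<in>S. A $$ (k, p k))) 0"
      using fin by (induction S rule: finite_induct) (simp_all add: monom_altdef mult_ac)
    show "coeff ((\<Prod>k\<in>S. [:- A $$ (k, p k):]) * (\<Prod>k\<in>{0..<n} - S. ?x k)) (n - i) =
      (if card S = i \<and> p permutes S then (- 1) ^ i * (\<Prod>k\<in>S. A $$ (k, p k)) else 0)"
    \<comment> \<open>As \<open>p\<close> is known to permute \<open>{0..<n}\<close>, it permutes \<open>S\<close> iff it fixes every other index.\<close>
    proof (cases "p permutes S")
      case True
      then have "(\<Prod>k\<in>{0..<n} - S. ?x k) = (\<Prod>k\<in>{0..<n} - S. monom 1 1)"
        by (intro prod.cong) (auto simp: permutes_not_in)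
      also have "\<dots> = monom 1 (n - card S)"
        by (simp add: card monom_power)
      finally show ?thesis
        using True card i by (auto simp: const mult_monom)
    next
      case False
      then obtain k where k: "k \<in> {0..<n} - S" "p k \<noteq> k"
        using permutes_superset[OF p, of S] by blast
      then have "(\<Prod>k\<in>{0..<n} - S. ?x k) = 0"
        by (intro prod_zero) auto
      then show ?thesis using False by simp
    qed
  qed
  finally show ?thesis .
qed

text \<open>
  The classical sum of principal minors, for an arbitrary weight: exchanging the two sums groups the
  permutations by the set \<open>S\<close> outside of which they are the identity. A permutation may occur for
  several \<open>S\<close>, one for each choice of the fixed points at which the constant term is taken.
\<close>

lemma coeff_immanant_char_poly_matrix:
  fixes A :: "'a :: comm_ring_1 mat"
  assumes A: "A \<in> carrier_mat n n" and i: "i \<le> n"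
  shows "(- 1) ^ i * coeff (immanant \<phi> (char_poly_matrix A)) (n - i) =
    (\<Sum>S | S \<subseteq> {0..<n} \<and> card S = i. \<Sum>p | p permutes S. of_int (\<phi> p) * (\<Prod>k\<in>S. A $$ (k, p k)))"
proof -
  let ?m = "\<lambda>S p. of_int (\<phi> p) * (\<Prod>k\<in>S. A $$ (k, p k))"
  have scale: "coeff (of_int z * q) m = of_int z * coeff q m" for z m and q :: "'a poly"
    by (simp add: of_int_poly)
  \<comment> \<open>The sign adjustment cancels the signs of the \<open>i\<close> constant terms.\<close>
  have sq: "(- 1) ^ i * (z * ((- 1) ^ i * y)) = z * y" for z y :: 'a
    by (simp add: mult.left_commute flip: mult.assoc power_mult_distrib)
  have "(- 1) ^ i * coeff (immanant \<phi> (char_poly_matrix A)) (n - i) =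
      (\<Sum>p | p permutes {0..<n}. (- 1) ^ i * (of_int (\<phi> p) *
        coeff (\<Prod>k = 0..<n. char_poly_matrix A $$ (k, p k)) (n - i)))"
    using char_poly_matrix_closed[OF A]
    by (simp add: immanant_def coeff_sum scale sum_distrib_left)
  also have "\<dots> = (\<Sum>p | p permutes {0..<n}. \<Sum>S \<in> Pow {0..<n}.
      if card S = i \<and> p permutes S then ?m S p else 0)"
    by (intro sum.cong refl)
      (auto simp: coeff_prod_char_poly_matrix[OF A _ i] sum_distrib_left sq intro!: sum.cong)
  also have "\<dots> = (\<Sum>S \<in> Pow {0..<n}. \<Sum>p | p permutes {0..<n}.
      if card S = i \<and> p permutes S then ?m S p else 0)"
    by (rule sum.swap)
  also have "\<dots> = (\<Sum>S \<in> Pow {0..<n}. if card S = i then \<Sum>p | p permutes S. ?m S p else 0)"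
  proof (rule sum.cong[OF refl])
    fix S assume "S \<in> Pow {0..<n}"
    then have "{p. p permutes {0..<n}} \<inter> {p. p permutes S} = {p. p permutes S}"
      by (auto intro: permutes_subset)
    then show "(\<Sum>p | p permutes {0..<n}. if card S = i \<and> p permutes S then ?m S p else 0) =
        (if card S = i then \<Sum>p | p permutes S. ?m S p else 0)"
      using sum.inter_restrict[of "{p. p permutes {0..<n}}" "?m S" "{p. p permutes S}"]
      by (simp add: finite_permutations)
  qed
  also have "\<dots> = (\<Sum>S \<in> Pow {0..<n} \<inter> {S. card S = i}. \<Sum>p | p permutes S. ?m S p)"
    by (simp add: sum.inter_restrict)
  also have "Pow {0..<n} \<inter> {S. card S = i} = {S. S \<subseteq> {0..<n} \<and> card S = i}"
    by auto
  finally show ?thesis .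
qed

section \<open>Expectations of immanants of Gram matrices\<close>

text \<open>
  Allows the subfamily \<open>x k\<close>, \<open>k \<in> S\<close>, to be renumbered by \<open>0, \<dots>, i - 1\<close>.
\<close>

lemma (in prob_space) indep_vars_reindex:
  assumes indep: "indep_vars M' X (e ` I)" and e: "inj_on e I"
  shows "indep_vars (\<lambda>k. M' (e k)) (\<lambda>k. X (e k)) I"
  unfolding indep_vars_def2
proof (intro conjI ballI)
  let ?F = "\<lambda>k. {X k -` A \<inter> space M |A. A \<in> sets (M' k)}"
  have rv: "\<And>k. k \<in> e ` I \<Longrightarrow> random_variable (M' k) (X k)" and sets: "indep_sets ?F (e ` I)"
    using indep by (auto simp: indep_vars_def2)
  show "random_variable (M' (e k)) (X (e k))" if "k \<in> I" for k
    using rv that by blast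
  show "indep_sets (\<lambda>k. ?F (e k)) I"
  proof (rule indep_setsI)
    show "?F (e k) \<subseteq> events" if "k \<in> I" for k
      using rv[of "e k"] that by (auto simp: measurable_sets)
  next
    fix A J assume J: "J \<noteq> {}" "J \<subseteq> I" "finite J" and A: "\<forall>j\<in>J. A j \<in> ?F (e j)"
    have eJ: "inj_on e J" using e J(2) by (rule inj_on_subset)
    have "prob (\<Inter>j\<in>e ` J. A (inv_into J e j)) = (\<Prod>j\<in>e ` J. prob (A (inv_into J e j)))"
      using J A eJ by (intro indep_setsD[OF sets]) auto
    then show "prob (\<Inter>j\<in>J. A j) = (\<Prod>j\<in>J. prob (A j))"
      using eJ by (simp add: prod.reindex)
  qed
qed

text \<open>
  The factors of the product are not independent of each other, as \<open>x k\<close> occurs in two of them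
  unless \<open>p k = k\<close>. Writing the dot products in coordinates, with \<open>f k\<close> the coordinate summed in the \<open>k\<close>-th
  one, the vector \<open>x k\<close> enters with coordinate \<open>f k\<close> in the \<open>k\<close>-th factor and with coordinate
  \<open>f (p\<inverse> k)\<close> in the factor where it is the second argument. Regrouping by vectors therefore gives
  products of independent integrable variables.
\<close>

lemma (in prob_space) expectation_prod_inner_permuted:
  fixes x :: "'i \<Rightarrow> 'a \<Rightarrow> real ^ 't"
  assumes I: "finite I" and p: "p permutes I"
    and w: "w \<in> borel_measurable N"
    and moments: "\<And>c d. integrable N (\<lambda>\<omega>. vec_nth (w \<omega>) c * vec_nth (w \<omega>) d)"
    and indep: "indep_vars (\<lambda>_. borel) x I"
    and ident: "\<And>k. k \<in> I \<Longrightarrow> distr M borel (x k) = distr N borel w"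
  shows "has_bochner_integral M (\<lambda>\<omega>. \<Prod>k\<in>I. inner (x k \<omega>) (x (p k) \<omega>))
    (\<Sum>f \<in> I \<rightarrow>\<^sub>E UNIV. \<Prod>k\<in>I. LINT \<omega>|N. vec_nth (w \<omega>) (f k) * vec_nth (w \<omega>) (f (inv_into UNIV p k)))"
proof -
  let ?h = "\<lambda>f k v. vec_nth v (f k) * vec_nth v (f (inv_into UNIV p k)) :: real"
  have h: "?h f k \<in> borel_measurable borel" for f :: "'i \<Rightarrow> 't" and k
    by measurable
  have rv: "x k \<in> borel_measurable M" if "k \<in> I" for k
    using indep that by (simp add: indep_vars_def2)
  have int: "integrable M (\<lambda>\<omega>. ?h f k (x k \<omega>))" if "k \<in> I" for f k
    using moments[of "f k" "f (inv_into UNIV p k)"] integrable_distr_eq[OF rv[OF that] h[of f k]]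
      integrable_distr_eq[OF w h[of f k]] ident[OF that] by simp
  have mean: "(LINT \<omega>|M. ?h f k (x k \<omega>)) = (LINT \<omega>|N. ?h f k (w \<omega>))" if "k \<in> I" for f k
    using integral_distr[OF rv[OF that] h[of f k]] integral_distr[OF w h[of f k]] ident[OF that] by simp
  have ind: "indep_vars (\<lambda>_. borel) (\<lambda>k \<omega>. ?h f k (x k \<omega>)) I" for f
    by (rule indep_vars_compose2[OF indep]) (rule h)
  have "has_bochner_integral M (\<lambda>\<omega>. \<Prod>k\<in>I. ?h f k (x k \<omega>)) (\<Prod>k\<in>I. LINT \<omega>|N. ?h f k (w \<omega>))" for f
    using indep_vars_integrable[OF I ind[of f] int] indep_vars_lebesgue_integral[OF I ind[of f] int]
    by (simp add: has_bochner_integral_iff mean)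
  then have "has_bochner_integral M (\<lambda>\<omega>. \<Sum>f \<in> I \<rightarrow>\<^sub>E UNIV. \<Prod>k\<in>I. ?h f k (x k \<omega>))
      (\<Sum>f \<in> I \<rightarrow>\<^sub>E UNIV. \<Prod>k\<in>I. LINT \<omega>|N. ?h f k (w \<omega>))"
    by (intro has_bochner_integral_sum)
  also have "(\<lambda>\<omega>. \<Sum>f \<in> I \<rightarrow>\<^sub>E UNIV. \<Prod>k\<in>I. ?h f k (x k \<omega>)) =
      (\<lambda>\<omega>. \<Prod>k\<in>I. inner (x k \<omega>) (x (p k) \<omega>))"
  proof
    fix \<omega>
    have "(\<Prod>k\<in>I. inner (x k \<omega>) (x (p k) \<omega>)) =
        (\<Sum>f \<in> I \<rightarrow>\<^sub>E UNIV. \<Prod>k\<in>I. vec_nth (x k \<omega>) (f k) * vec_nth (x (p k) \<omega>) (f k))"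
      using I by (simp add: inner_vec_def prod_sum_PiE)
    also have "\<dots> = (\<Sum>f \<in> I \<rightarrow>\<^sub>E UNIV. \<Prod>k\<in>I. ?h f k (x k \<omega>))"
    proof (rule sum.cong[OF refl])
      fix f :: "'i \<Rightarrow> 't"
      have "(\<Prod>k\<in>I. vec_nth (x (p k) \<omega>) (f k)) = (\<Prod>k\<in>I. vec_nth (x k \<omega>) (f (inv_into UNIV p k)))"
        using prod.permute[OF p, of "\<lambda>k. vec_nth (x k \<omega>) (f (inv_into UNIV p k))"]
        by (simp add: comp_def permutes_inverses[OF p])
      then show "(\<Prod>k\<in>I. vec_nth (x k \<omega>) (f k) * vec_nth (x (p k) \<omega>) (f k)) =
          (\<Prod>k\<in>I. ?h f k (x k \<omega>))"
        by (simp add: prod.distrib)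
    qed
    finally show "(\<Sum>f \<in> I \<rightarrow>\<^sub>E UNIV. \<Prod>k\<in>I. ?h f k (x k \<omega>)) =
        (\<Prod>k\<in>I. inner (x k \<omega>) (x (p k) \<omega>))" ..
  qed
  finally show ?thesis .
qed

lemma immanant_gram_mat:
  "immanant \<phi> (gram_mat m y) =
    (\<Sum>p | p permutes {0..<m}. of_int (\<phi> p) * (\<Prod>k = 0..<m. inner (y k) (y (p k))))"
proof -
  have "gram_mat m y $$ (k, p k) = inner (y k) (y (p k))"
    if "p permutes {0..<m}" "k \<in> {0..<m}" for p k
    using that permutes_in_image[of p "{0..<m}" k] by (simp add: gram_mat_def)
  then show ?thesis
    using carrier_matD(1)[OF gram_mat_carrier[of m y]] by (simp add: immanant_def)
qed

text \<open>
  The expected immanant in terms of second moments. It depends only on the distribution of \<open>w\<close> and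
  on the size, which makes it possible to compare Gram matrices on different probability spaces.
\<close>

definition gram_immanant_mean ::
  "((nat \<Rightarrow> nat) \<Rightarrow> int) \<Rightarrow> 'b measure \<Rightarrow> ('b \<Rightarrow> real ^ 't) \<Rightarrow> nat \<Rightarrow> real" where
  "gram_immanant_mean \<phi> N w m = (\<Sum>p | p permutes {0..<m}. of_int (\<phi> p) *
     (\<Sum>f \<in> {0..<m} \<rightarrow>\<^sub>E UNIV. \<Prod>k = 0..<m.
        LINT \<omega>|N. vec_nth (w \<omega>) (f k) * vec_nth (w \<omega>) (f (inv_into UNIV p k))))"

lemma (in prob_space) expectation_immanant_gram_mat:
  fixes x :: "nat \<Rightarrow> 'a \<Rightarrow> real ^ 't"
  assumes w: "w \<in> borel_measurable N"
    and moments: "\<And>c d. integrable N (\<lambda>\<omega>. vec_nth (w \<omega>) c * vec_nth (w \<omega>) d)"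
    and indep: "indep_vars (\<lambda>_. borel) x {0..<m}"
    and ident: "\<And>k. k < m \<Longrightarrow> distr M borel (x k) = distr N borel w"
  shows "has_bochner_integral M (\<lambda>\<omega>. immanant \<phi> (gram_mat m (\<lambda>k. x k \<omega>)))
    (gram_immanant_mean \<phi> N w m)"
proof -
  show ?thesis
    unfolding gram_immanant_mean_def immanant_gram_mat
    using w moments indep ident
    by (auto intro!: has_bochner_integral_sum has_bochner_integral_mult_right
        expectation_prod_inner_permuted)
qed

text \<open>
  Each of the \<open>n choose i\<close> principal submatrices is the Gram matrix of \<open>i\<close> independent copies of
  \<open>w\<close>, so all contribute the same mean.
\<close>

lemma (in prob_space) expectation_coeff_immanant_gram_mat:
  fixes x :: "nat \<Rightarrow> 'a \<Rightarrow> real ^ 't"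
  assumes \<phi>: "relabelling_invariant \<phi>"
    and w: "w \<in> borel_measurable N"
    and moments: "\<And>c d. integrable N (\<lambda>\<omega>. vec_nth (w \<omega>) c * vec_nth (w \<omega>) d)"
    and indep: "indep_vars (\<lambda>_. borel) x {0..<n}"
    and ident: "\<And>k. k < n \<Longrightarrow> distr M borel (x k) = distr N borel w"
    and i: "i \<le> n"
  shows "has_bochner_integral M
    (\<lambda>\<omega>. (- 1) ^ i * coeff (immanant \<phi> (char_poly_matrix (gram_mat n (\<lambda>k. x k \<omega>)))) (n - i))
    (real (n choose i) * gram_immanant_mean \<phi> N w i)"
proof -
  let ?\<S> = "{S. S \<subseteq> {0..<n} \<and> card S = i}"
  let ?m = "\<lambda>S \<omega>. \<Sum>p | p permutes S. of_int (\<phi> p) * (\<Prod>k\<in>S. inner (x k \<omega>) (x (p k) \<omega>))"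
  have minor: "has_bochner_integral M (?m S) (gram_immanant_mean \<phi> N w i)" if S: "S \<in> ?\<S>" for S
  proof -
    have "finite S" using S by (auto intro: finite_subset)
    then obtain e where e: "bij_betw e {0..<i} S"
      using S ex_bij_betw_nat_finite by blast
    have img: "e ` {0..<i} = S" "inj_on e {0..<i}"
      using e by (auto simp: bij_betw_def)
    have "indep_vars (\<lambda>_. borel) x (e ` {0..<i})"
      using indep S img by (auto intro: indep_vars_subset)
    from indep_vars_reindex[OF this img(2)]
    have "has_bochner_integral M (\<lambda>\<omega>. immanant \<phi> (gram_mat i (\<lambda>k. x (e k) \<omega>)))
        (gram_immanant_mean \<phi> N w i)"
    proof (rule expectation_immanant_gram_mat[OF w moments])
      fix k assume "k < i"
      then have "e k \<in> S" using img(1) by auto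
      then have "e k < n" using S by auto
      then show "distr M borel (x (e k)) = distr N borel w" by (rule ident)
    qed
    also have "(\<lambda>\<omega>. immanant \<phi> (gram_mat i (\<lambda>k. x (e k) \<omega>))) = ?m S"
    proof
      fix \<omega>
      have "?m S \<omega> = (\<Sum>p | p permutes {0..<i}. of_int (\<phi> p) *
          (\<Prod>k = 0..<i. inner (x (e k) \<omega>) (x (e (p k)) \<omega>)))"
        by (rule sum_permutes_relabel[OF \<phi> finite_atLeastLessThan e])
      then show "immanant \<phi> (gram_mat i (\<lambda>k. x (e k) \<omega>)) = ?m S \<omega>"
        by (simp add: immanant_gram_mat)
    qed
    finally show ?thesis .
  qed
  have "has_bochner_integral M (\<lambda>\<omega>. \<Sum>S\<in>?\<S>. ?m S \<omega>) (\<Sum>S\<in>?\<S>. gram_immanant_mean \<phi> N w i)"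
    by (rule has_bochner_integral_sum) (rule minor)
  also have "(\<Sum>S\<in>?\<S>. gram_immanant_mean \<phi> N w i) = real (n choose i) * gram_immanant_mean \<phi> N w i"
    by (simp add: n_subsets)
  also have "(\<lambda>\<omega>. \<Sum>S\<in>?\<S>. ?m S \<omega>) =
      (\<lambda>\<omega>. (- 1) ^ i * coeff (immanant \<phi> (char_poly_matrix (gram_mat n (\<lambda>k. x k \<omega>)))) (n - i))"
  proof
    fix \<omega>
    have "gram_mat n (\<lambda>k. x k \<omega>) $$ (k, p k) = inner (x k \<omega>) (x (p k) \<omega>)"
      if "S \<in> ?\<S>" "p permutes S" "k \<in> S" for S p k
    proof -
      have "k < n" "p k < n"
        using that permutes_in_image[of p S k] by auto
      then show ?thesis by (simp add: gram_mat_def)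
    qed
    then show "(\<Sum>S\<in>?\<S>. ?m S \<omega>) =
        (- 1) ^ i * coeff (immanant \<phi> (char_poly_matrix (gram_mat n (\<lambda>k. x k \<omega>)))) (n - i)"
      unfolding coeff_immanant_char_poly_matrix[OF gram_mat_carrier i] by simp
  qed
  finally show ?thesis .
qed

theorem theorem4:
  fixes N :: "'b measure" and w :: "'b \<Rightarrow> real ^ 't"
    and M :: "nat \<Rightarrow> 'a measure" and W :: "nat \<Rightarrow> nat \<Rightarrow> 'a \<Rightarrow> real ^ 't"
    and n i :: nat
  assumes N: "prob_space N"
    and w: "w \<in> borel_measurable N"
    and moments: "\<And>c d. integrable N (\<lambda>\<omega>. vec_nth (w \<omega>) c * vec_nth (w \<omega>) d)"
    and M: "\<And>m. prob_space (M m)"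
    and indep: "\<And>m. prob_space.indep_vars (M m) (\<lambda>_. borel) (W m) {..<m}"
    and ident: "\<And>m k. k < m \<Longrightarrow> distr (M m) borel (W m k) = distr N borel w"
    and i: "i \<le> n"
  shows "integrable (M n) (\<lambda>\<omega>. char_coeff (gram_mat n (\<lambda>k. W n k \<omega>)) i) \<and>
    (LINT \<omega>|M n. char_coeff (gram_mat n (\<lambda>k. W n k \<omega>)) i) =
      real (n choose i) * (LINT \<omega>|M i. Determinant.det (gram_mat i (\<lambda>k. W i k \<omega>))) \<and>
    integrable (M n) (\<lambda>\<omega>. perm_coeff (gram_mat n (\<lambda>k. W n k \<omega>)) i) \<and>
    (LINT \<omega>|M n. perm_coeff (gram_mat n (\<lambda>k. W n k \<omega>)) i) =
      real (n choose i) * (LINT \<omega>|M i. permanent (gram_mat i (\<lambda>k. W i k \<omega>)))"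
proof -
  have mean: "has_bochner_integral (M i) (\<lambda>\<omega>. immanant \<phi> (gram_mat i (\<lambda>k. W i k \<omega>)))
      (gram_immanant_mean \<phi> N w i)" for \<phi>
    using prob_space.expectation_immanant_gram_mat[OF M w moments, of i "W i" i \<phi>] indep[of i] ident[of _ i]
    by (simp add: atLeast0LessThan)
  have coeff: "has_bochner_integral (M n)
      (\<lambda>\<omega>. (- 1) ^ i * coeff (immanant \<phi> (char_poly_matrix (gram_mat n (\<lambda>k. W n k \<omega>)))) (n - i))
      (real (n choose i) * gram_immanant_mean \<phi> N w i)" if "relabelling_invariant \<phi>" for \<phi>
    using prob_space.expectation_coeff_immanant_gram_mat[OF M that w moments, of n "W n" n i]
      indep[of n] ident[of _ n] i
    by (simp add: atLeast0LessThan)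
  have char: "char_coeff (gram_mat n y) i =
      (- 1) ^ i * coeff (immanant sign (char_poly_matrix (gram_mat n y))) (n - i)"
    for y :: "nat \<Rightarrow> real ^ 't"
    using det_eq_immanant[OF char_poly_matrix_closed[OF gram_mat_carrier[of n y]]]
      carrier_matD(1)[OF gram_mat_carrier[of n y]]
    by (simp add: char_coeff_def char_poly_def)
  have perm: "perm_coeff (gram_mat n y) i =
      (- 1) ^ i * coeff (immanant (\<lambda>_. 1) (char_poly_matrix (gram_mat n y))) (n - i)"
    for y :: "nat \<Rightarrow> real ^ 't"
    using permanent_eq_immanant[OF char_poly_matrix_closed[OF gram_mat_carrier[of n y]]]
      carrier_matD(1)[OF gram_mat_carrier[of n y]]
    by (simp add: perm_coeff_def perm_poly_def)
  show ?thesis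
    using coeff[OF relabelling_invariant_sign] coeff[OF relabelling_invariant_one]
      mean[of sign] mean[of "\<lambda>_. 1"]
    unfolding char perm det_eq_immanant[OF gram_mat_carrier] permanent_eq_immanant[OF gram_mat_carrier]
    by (simp add: has_bochner_integral_iff)
qed

end
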